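(* Let $(G,D)$ be a connected $3$-transposition group, $M=M_\eta(G,D)$, let $\sigma$ be a flip of $M$ and $W=[M,\sigma]=\{u-u^\sigma\mid u\in M\}$. Let $\Lambda$ be the set of eigenvalues of the collinearity map $t$ on $M$ and, for $\lambda\in\Lambda$, let $m_\lambda$ (possibly zero) be the dimension of the $\lambda$-eigenspace of $t$ in $W$. Then $$\sum_{\lambda\in\Lambda}m_\lambda\lambda=-e,$$ where $e$ is the number of non-orthogonal orbits of $\langle\sigma\rangle$ on $D$, that is, the number of orbits $\{c,c^\sigma\}$ of length two with $|cc^\sigma|=3$.
   Context: $\mathbb F$ is a field of characteristic $0$ and $\eta\in\mathbb F\setminus\{0,1\}$. A $3$-transposition group $(G,D)$ is a finite group $G$ with a normal generating subset $D$ of elements of order $2$ such that $|de|\le 3$ for all $d,e\in D$; it is connected if $D$ is a single conjugacy class. As a vector space, the Matsuo algebra $M=M_\eta(G,D)$ is the $\mathbb F$-space with basis $D$ (the algebra product is not needed here). A flip $\sigma$ of $M$ is an automorphism of order $2$ of the group $G$ with $D^\sigma=D$, acting linearly on $M$ by permuting the basis $D$. The collinearity map is the linear map $t:M\to M$ with $t(d)=\sum_{c\in D,\,|cd|=3}c$ for $d\in D$. It commutes with $\sigma$, so it leaves $W$ invariant. It is a known fact (from the tables of spectra of $3$-transposition groups by Hall and Shpectorov) that all eigenvalues of $t$ are integers, so in particular they lie in $\mathbb F$. *)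

theory Defs
  imports "HOL-Algebra.Multiplicative_Group" "HOL-Algebra.Bij" "HOL-Library.Function_Algebras"
begin

text \<open>HOL-Algebra assigns order \<open>0\<close> to elements of infinite order; finiteness of the group
  rules this out in the bound on \<open>ord (d \<otimes> e)\<close>.\<close>

locale three_transposition_group = group G for G (structure) +
  fixes D :: "'a set"
  assumes finite_carrier: "finite (carrier G)"
    and D_subset: "D \<subseteq> carrier G"
    and D_normal: "\<lbrakk>g \<in> carrier G; d \<in> D\<rbrakk> \<Longrightarrow> g \<otimes> d \<otimes> inv g \<in> D"
    and D_generates: "generate G D = carrier G"
    and D_order: "d \<in> D \<Longrightarrow> ord d = 2"
    and ord_mult_le: "\<lbrakk>d \<in> D; e \<in> D\<rbrakk> \<Longrightarrow> ord (d \<otimes> e) \<le> 3"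

locale connected_three_transposition_group = three_transposition_group +
  assumes single_class: "\<exists>d\<in>carrier G. D = {g \<otimes> d \<otimes> inv g | g. g \<in> carrier G}"

text \<open>Elements of \<^term>\<open>carrier (AutoGroup G)\<close> are extensional, i.e. \<^term>\<open>undefined\<close>
  outside the carrier of \<^term>\<open>G\<close>.\<close>

definition flip :: "('a, 'b) monoid_scheme \<Rightarrow> 'a set \<Rightarrow> ('a \<Rightarrow> 'a) \<Rightarrow> bool" where
  "flip G D \<sigma> \<longleftrightarrow>
     \<sigma> \<in> carrier (AutoGroup G) \<and> group.ord (AutoGroup G) \<sigma> = 2 \<and> \<sigma> ` D = D"

text \<open>The Matsuo algebra as a vector space: the functions to the field vanishing off \<^term>\<open>D\<close>,
  where \<open>basis_vec d\<close> is the basis vector identified with \<^term>\<open>d \<in> D\<close>. The space does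
  not depend on the parameter \<open>\<eta>\<close>, which only enters the product.\<close>

definition scale_fun :: "'f::field \<Rightarrow> ('a \<Rightarrow> 'f) \<Rightarrow> 'a \<Rightarrow> 'f" where
  "scale_fun k u = (\<lambda>x. k * u x)"

interpretation fun_space: vector_space "scale_fun :: 'f::field \<Rightarrow> ('a \<Rightarrow> 'f) \<Rightarrow> 'a \<Rightarrow> 'f"
  by unfold_locales (auto simp: scale_fun_def fun_eq_iff algebra_simps)

definition matsuo_space :: "'a set \<Rightarrow> ('a \<Rightarrow> 'f::field) set" where
  "matsuo_space D = {u. \<forall>x. x \<notin> D \<longrightarrow> u x = 0}"

definition basis_vec :: "'a \<Rightarrow> 'a \<Rightarrow> 'f::field" where
  "basis_vec d = (\<lambda>x. if x = d then 1 else 0)"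

definition linear_extension :: "'a set \<Rightarrow> ('a \<Rightarrow> 'a \<Rightarrow> 'f) \<Rightarrow> ('a \<Rightarrow> 'f) \<Rightarrow> 'a \<Rightarrow> 'f::field" where
  "linear_extension D \<phi> u = (\<Sum>d\<in>D. scale_fun (u d) (\<phi> d))"

definition collinearity_map ::
    "('a, 'b) monoid_scheme \<Rightarrow> 'a set \<Rightarrow> ('a \<Rightarrow> 'f) \<Rightarrow> 'a \<Rightarrow> 'f::field" where
  "collinearity_map G D =
     linear_extension D (\<lambda>d. \<Sum>c\<in>{c \<in> D. group.ord G (c \<otimes>\<^bsub>G\<^esub> d) = 3}. basis_vec c)"

definition flip_action :: "'a set \<Rightarrow> ('a \<Rightarrow> 'a) \<Rightarrow> ('a \<Rightarrow> 'f) \<Rightarrow> 'a \<Rightarrow> 'f::field" where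
  "flip_action D \<sigma> = linear_extension D (\<lambda>d. basis_vec (\<sigma> d))"

text \<open>The subspace \<open>[M, \<sigma>]\<close>.\<close>

definition flip_commutator :: "'a set \<Rightarrow> ('a \<Rightarrow> 'a) \<Rightarrow> ('a \<Rightarrow> 'f::field) set" where
  "flip_commutator D \<sigma> = {u - flip_action D \<sigma> u | u. u \<in> matsuo_space D}"

definition eigenspace ::
    "(('a \<Rightarrow> 'f) \<Rightarrow> 'a \<Rightarrow> 'f) \<Rightarrow> ('a \<Rightarrow> 'f::field) set \<Rightarrow> 'f \<Rightarrow> ('a \<Rightarrow> 'f) set" where
  "eigenspace t V l = {u \<in> V. t u = scale_fun l u}"

definition eigenvalues ::
    "(('a \<Rightarrow> 'f) \<Rightarrow> 'a \<Rightarrow> 'f) \<Rightarrow> ('a \<Rightarrow> 'f::field) set \<Rightarrow> 'f set" where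
  "eigenvalues t V = {l. \<exists>u\<in>V. u \<noteq> 0 \<and> t u = scale_fun l u}"

definition flip_orbits :: "('a, 'b) monoid_scheme \<Rightarrow> 'a set \<Rightarrow> ('a \<Rightarrow> 'a) \<Rightarrow> 'a set set" where
  "flip_orbits G D \<sigma> = (\<lambda>c. {\<tau> c | \<tau>. \<tau> \<in> generate (AutoGroup G) {\<sigma>}}) ` D"

definition nonorthogonal_orbits ::
    "('a, 'b) monoid_scheme \<Rightarrow> 'a set \<Rightarrow> ('a \<Rightarrow> 'a) \<Rightarrow> 'a set set" where
  "nonorthogonal_orbits G D \<sigma> =
     {Q \<in> flip_orbits G D \<sigma>.
        card Q = 2 \<and> (\<exists>c. Q = {c, \<sigma> c} \<and> group.ord G (c \<otimes>\<^bsub>G\<^esub> \<sigma> c) = 3)}"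

end

theory Submission imports Defs "HOL-Computational_Algebra.Fundamental_Theorem_Algebra" begin

text \<open>If \<open>P = (1 - \<sigma>) / 2\<close> denotes the projection onto \<open>W\<close>, then \<open>t P\<close> has trace
  \<open>\<Sum> m\<^sub>\<lambda> \<lambda>\<close>, provided that \<open>t\<close> is diagonalizable over the field; on the other hand the trace is
  \<open>(tr t - tr (t \<sigma>)) / 2 = - e\<close>, because \<open>t\<close> has zero diagonal and \<open>tr (t \<sigma>)\<close> counts the \<open>d\<close> with
  \<open>|d d\<^sup>\<sigma>| = 3\<close>.

  Diagonalizability does not need the tables of spectra. Up to a scalar, \<open>t\<close> is the sum of the
  conjugations by the elements of \<open>D\<close>, and it commutes with each of them. Taking traces on an
  eigenspace over the complex numbers, where every involution has integral trace, shows that the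
  eigenvalue is rational. As \<open>t\<close> is symmetric, its minimal polynomial is squarefree, so it is a
  product of distinct rational linear factors, and this remains true over every field of
  characteristic \<open>0\<close>.\<close>

section \<open>Traces and polynomials of linear maps\<close>

interpretation fun_pair: vector_space_pair
    "scale_fun :: 'f::field \<Rightarrow> ('a \<Rightarrow> 'f) \<Rightarrow> 'a \<Rightarrow> 'f" "scale_fun :: 'f \<Rightarrow> ('b \<Rightarrow> 'f) \<Rightarrow> 'b \<Rightarrow> 'f"
  by unfold_locales

abbreviation fun_linear :: "(('a \<Rightarrow> 'f) \<Rightarrow> 'a \<Rightarrow> 'f::field) \<Rightarrow> bool" where
  "fun_linear \<equiv> Vector_Spaces.linear scale_fun scale_fun"

lemma fun_linearI:
  fixes f :: "('a \<Rightarrow> 'f) \<Rightarrow> 'a \<Rightarrow> 'f::field"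
  assumes "\<And>u v. f (u + v) = f u + f v" "\<And>k u. f (scale_fun k u) = scale_fun k (f u)"
  shows "fun_linear f"
  unfolding Vector_Spaces.linear_iff using assms fun_space.vector_space_axioms by blast

section \<open>Finite-dimensionality of the Matsuo space\<close>

lemma subspace_matsuo_space: "fun_space.subspace (matsuo_space D :: ('a \<Rightarrow> 'f::field) set)"
  by (auto simp: fun_space.subspace_def matsuo_space_def scale_fun_def)

lemma basis_vec_in_matsuo_space: "d \<in> D \<Longrightarrow> basis_vec d \<in> matsuo_space D"
  by (auto simp: basis_vec_def matsuo_space_def)

lemma sum_fun_apply: "(sum f A) x = (\<Sum>a\<in>A. f a x)" for f :: "'b \<Rightarrow> 'a \<Rightarrow> 'f::field"
  by (induction A rule: infinite_finite_induct) auto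

lemma matsuo_space_expand:
  fixes u :: "'a \<Rightarrow> 'f::field"
  assumes "finite D" "u \<in> matsuo_space D"
  shows "u = (\<Sum>d\<in>D. scale_fun (u d) (basis_vec d))"
proof
  fix x
  have "(\<Sum>d\<in>D. scale_fun (u d) (basis_vec d)) x = (\<Sum>d\<in>D. if x = d then u d else 0)"
    unfolding sum_fun_apply by (rule sum.cong) (auto simp: scale_fun_def basis_vec_def)
  also have "\<dots> = u x"
    using assms by (auto simp: matsuo_space_def)
  finally show "u x = (\<Sum>d\<in>D. scale_fun (u d) (basis_vec d)) x" ..
qed

lemma matsuo_space_subset_span:
  assumes "finite D"
  shows "(matsuo_space D :: ('a \<Rightarrow> 'f::field) set) \<subseteq> fun_space.span (basis_vec ` D)"
proof
  fix u :: "'a \<Rightarrow> 'f" assume "u \<in> matsuo_space D"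
  then have "u = (\<Sum>d\<in>D. scale_fun (u d) (basis_vec d))"
    by (rule matsuo_space_expand[OF assms])
  moreover have "(\<Sum>d\<in>D. scale_fun (u d) (basis_vec d)) \<in> fun_space.span (basis_vec ` D)"
    by (intro fun_space.span_sum fun_space.span_scale fun_space.span_base imageI)
  ultimately show "u \<in> fun_space.span (basis_vec ` D)" by simp
qed

text \<open>The space of all functions on \<open>'a\<close> may have infinite dimension, so
  finiteness of bases inside \<open>matsuo_space D\<close> is drawn from its finite spanning
  set.\<close>

lemma independent_matsuo_space_bound:
  fixes B :: "('a \<Rightarrow> 'f::field) set"
  assumes "finite D" "fun_space.independent B" "B \<subseteq> matsuo_space D"
  shows "finite B \<and> card B \<le> card D"
proof -
  have "finite B \<and> card B \<le> card (basis_vec ` D :: ('a \<Rightarrow> 'f) set)"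
    using assms matsuo_space_subset_span[OF assms(1)] 
    by (intro fun_space.independent_span_bound) auto
  then show ?thesis using card_image_le[OF assms(1), of "basis_vec :: 'a \<Rightarrow> 'a \<Rightarrow> 'f"] by simp
qed

text \<open>The matrix trace with respect to the basis \<open>D\<close>. To take the trace of a map
  on a subspace, the map is first composed with a projection onto that subspace.\<close>

definition trace_on :: "'a set \<Rightarrow> (('a \<Rightarrow> 'f) \<Rightarrow> 'a \<Rightarrow> 'f) \<Rightarrow> 'f::field" where
  "trace_on D f = (\<Sum>d\<in>D. f (basis_vec d) d)"

text \<open>Coordinates with respect to a basis of the image, extended along the projection, are
  dual to that basis, so each basis vector contributes \<open>1\<close> to the trace.\<close>

lemma trace_projection:
  fixes P :: "('a \<Rightarrow> 'f) \<Rightarrow> 'a \<Rightarrow> 'f::field"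
  assumes fin: "finite D" and lin: "fun_linear P"
    and V: "fun_space.subspace V" "V \<subseteq> matsuo_space D"
    and into: "\<And>u. u \<in> matsuo_space D \<Longrightarrow> P u \<in> V" and fixed: "\<And>v. v \<in> V \<Longrightarrow> P v = v"
  shows "trace_on D P = of_nat (fun_space.dim V)"
proof -
  obtain B where B: "B \<subseteq> V" "fun_space.independent B" "V \<subseteq> fun_space.span B"
      "card B = fun_space.dim V"
    by (rule fun_space.basis_exists)
  have finB: "finite B"
    using independent_matsuo_space_bound[OF fin B(2)] B(1) V(2) by auto
  let ?r = "\<lambda>d. fun_space.representation B (P (basis_vec d))"
  have in_span: "P (basis_vec d) \<in> fun_space.span B" if "d \<in> D" for d
    using into[OF basis_vec_in_matsuo_space[OF that]] B(3) by auto
  have dual: "(\<Sum>d\<in>D. b d * ?r d b) = 1" if "b \<in> B" for b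
  proof -
    have "b \<in> matsuo_space D" "b \<in> V" using that B(1) V(2) by auto
    \<comment> \<open>Expanding \<open>b\<close> in the basis \<open>D\<close> and applying
      \<open>P\<close>, which fixes it, yields an equation whose coordinate at \<open>b\<close> is
      \<open>1\<close> on the left.\<close>
    have "b = P (\<Sum>d\<in>D. scale_fun (b d) (basis_vec d))"
      using matsuo_space_expand[OF fin \<open>b \<in> matsuo_space D\<close>] fixed[OF \<open>b \<in> V\<close>] by simp
    also have "\<dots> = (\<Sum>d\<in>D. scale_fun (b d) (P (basis_vec d)))"
      by (simp add: fun_pair.linear_sum[OF lin] fun_pair.linear_scale[OF lin])
    finally have b_eq: "b = \<dots>" .
    have "1 = fun_space.representation B b b"
      by (simp add: fun_space.representation_basis[OF B(2) that])
    also have "\<dots> = fun_space.representation B (\<Sum>d\<in>D. scale_fun (b d) (P (basis_vec d))) b"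
      using b_eq by simp
    also have "\<dots> = (\<Sum>d\<in>D. b d * ?r d b)"
      by (simp add: fun_space.representation_sum[OF B(2)] fun_space.representation_scale[OF B(2)]
          in_span fun_space.span_scale)
    finally show ?thesis by simp
  qed
  have "P (basis_vec d) = (\<Sum>b\<in>B. scale_fun (?r d b) b)" if "d \<in> D" for d
    by (rule fun_space.sum_representation_eq[symmetric, OF B(2) in_span[OF that] finB order_refl])
  then have "trace_on D P = (\<Sum>d\<in>D. (\<Sum>b\<in>B. scale_fun (?r d b) b) d)"
    unfolding trace_on_def by (intro sum.cong refl) metis
  also have "\<dots> = (\<Sum>d\<in>D. \<Sum>b\<in>B. b d * ?r d b)"
    by (simp add: sum_fun_apply scale_fun_def mult.commute)
  also have "\<dots> = (\<Sum>b\<in>B. \<Sum>d\<in>D. b d * ?r d b)"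
    by (rule sum.swap)
  also have "\<dots> = of_nat (card B)"
    by (simp add: dual)
  finally show ?thesis using B(4) by simp
qed

text \<open>A left inverse on \<open>V\<close> of the identity, chosen with range in
  \<open>V\<close>, is such a projection.\<close>

lemma projection_exists:
  fixes V :: "('a \<Rightarrow> 'f::field) set"
  assumes "fun_space.subspace V"
  obtains P where "fun_linear P" "\<And>u. P u \<in> V" "\<And>v. v \<in> V \<Longrightarrow> P v = v"
  using fun_pair.linear_exists_left_inverse_on[OF fun_space.linear_id assms] by auto

section \<open>Polynomials of a linear map, evaluated on vectors by Horner's scheme\<close>

definition poly_map :: "(('a \<Rightarrow> 'f) \<Rightarrow> 'a \<Rightarrow> 'f) \<Rightarrow> 'f poly \<Rightarrow> ('a \<Rightarrow> 'f) \<Rightarrow> 'a \<Rightarrow> 'f::field" where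
  "poly_map T p u = fold_coeffs (\<lambda>c w. scale_fun c u + T w) p 0"

context
  fixes T :: "('a \<Rightarrow> 'f) \<Rightarrow> 'a \<Rightarrow> 'f::field"
  assumes T: "fun_linear T"
begin

(* Inductions over p leave eta-expanded vectors, which the pointwise rules would take apart. *)
declare plus_fun_apply [simp del] zero_fun_apply [simp del]

lemma poly_map_0 [simp]: "poly_map T 0 u = 0"
  by (simp add: poly_map_def)

lemma poly_map_pCons [simp]: "poly_map T (pCons c p) u = scale_fun c u + T (poly_map T p u)"
  \<comment> \<open>\<open>pCons 0 0\<close> is the zero polynomial, and there the recursion amounts
    to \<open>T 0 = 0\<close>.\<close>
  by (cases "c = 0 \<and> p = 0") (auto simp: poly_map_def fun_pair.linear_0[OF T])

lemma poly_map_add: "poly_map T (p + q) u = poly_map T p u + poly_map T q u"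
proof (induction p q rule: poly_induct2)
  case (pCons a p b q)
  then show ?case
    by (simp add: fun_space.scale_left_distrib fun_pair.linear_add[OF T])
qed simp

lemma poly_map_smult: "poly_map T (smult c p) u = scale_fun c (poly_map T p u)"
  by (induction p) (simp_all add: fun_space.scale_right_distrib fun_pair.linear_scale[OF T])

lemma poly_map_mult: "poly_map T (p * q) u = poly_map T p (poly_map T q u)"
  by (induction p) (simp_all add: poly_map_add poly_map_smult)

lemma poly_map_sum: "poly_map T (\<Sum>i\<in>I. f i) u = (\<Sum>i\<in>I. poly_map T (f i) u)"
  by (induction I rule: infinite_finite_induct) (simp_all add: poly_map_add)

lemma poly_map_1 [simp]: "poly_map T 1 u = u"
  by (simp add: one_pCons fun_pair.linear_0[OF T])

lemma poly_map_monom: "poly_map T (monom c n) u = scale_fun c ((T ^^ n) u)"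
  by (induction n) (simp_all add: monom_0 monom_Suc fun_pair.linear_0[OF T] fun_pair.linear_scale[OF T])

lemma poly_map_root: "poly_map T [:-a, 1:] u = T u - scale_fun a u"
  by (simp add: fun_pair.linear_0[OF T])

lemma poly_map_commute:
  assumes "fun_linear F" "\<And>u. F (T u) = T (F u)"
  shows "F (poly_map T p u) = poly_map T p (F u)"
  by (induction p) (simp_all add: fun_pair.linear_0[OF assms(1)] fun_pair.linear_add[OF assms(1)]
      fun_pair.linear_scale[OF assms(1)] assms(2))

lemma linear_poly_map: "fun_linear (poly_map T p)"
proof (rule fun_linearI)
  show "poly_map T p (u + v) = poly_map T p u + poly_map T p v" for u v
    by (induction p) (simp_all add: fun_space.scale_right_distrib fun_pair.linear_add[OF T])
  show "poly_map T p (scale_fun k u) = scale_fun k (poly_map T p u)" for k u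
    by (induction p) (simp_all add: fun_space.scale_right_distrib fun_pair.linear_scale[OF T] 
        fun_space.scale_left_commute)
qed

lemma poly_map_eigenvector:
  assumes "T u = scale_fun l u"
  shows "poly_map T p u = scale_fun (poly p l) u"
  by (induction p) (simp_all add: fun_pair.linear_scale[OF T] assms fun_space.scale_left_distrib
      mult.commute)

lemma poly_map_in_subspace:
  assumes "fun_space.subspace V" "\<And>v. v \<in> V \<Longrightarrow> T v \<in> V" "u \<in> V"
  shows "poly_map T p u \<in> V"
  by (induction p) (simp_all add: assms fun_space.subspace_0 fun_space.subspace_add
      fun_space.subspace_scale)

lemma subspace_eigenspace:
  assumes "fun_space.subspace V"
  shows "fun_space.subspace (eigenspace T V l)"
  using assms by (auto simp: fun_space.subspace_def eigenspace_def fun_pair.linear_0[OF T]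
    fun_pair.linear_add[OF T] fun_pair.linear_scale[OF T] fun_space.scale_right_distrib mult.commute)

text \<open>The \<open>card D + 1\<close> iterates of \<open>v\<close> lie in a space of dimension
  at most \<open>card D\<close>; the coefficients of a linear relation among them form the
  polynomial.\<close>

lemma vector_annihilator:
  assumes fin: "finite D" and inv: "\<And>u. u \<in> matsuo_space D \<Longrightarrow> T u \<in> matsuo_space D"
    and v: "v \<in> matsuo_space D"
  obtains p where "p \<noteq> 0" "poly_map T p v = 0"
proof -
  let ?I = "{..card D}" and ?w = "\<lambda>n. (T ^^ n) v"
  have w: "?w n \<in> matsuo_space D" for n
    by (induction n) (use v inv in auto)
  show ?thesis
  \<comment> \<open>Dependence is a property of the set of iterates and does not see repetitions.
    Two equal iterates give the relation \<open>T^i v - T^j v = 0\<close> directly.\<close>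
  proof (cases "inj_on ?w ?I")
    case True
    have "fun_space.dependent (?w ` ?I)"
      using independent_matsuo_space_bound[OF fin, of "?w ` ?I"] w card_image[OF True] by fastforce
    then obtain f where f: "(\<Sum>x\<in>?w ` ?I. scale_fun (f x) x) = 0" "\<exists>x\<in>?w ` ?I. f x \<noteq> 0"
      by (auto simp: fun_space.dependent_finite)
    define p where "p = (\<Sum>n\<in>?I. monom (f (?w n)) n)"
    have "poly_map T p v = (\<Sum>n\<in>?I. scale_fun (f (?w n)) (?w n))"
      by (simp add: p_def poly_map_sum poly_map_monom)
    also have "\<dots> = 0"
      using f(1) by (simp add: sum.reindex[OF True])
    finally have "poly_map T p v = 0" .
    moreover from f(2) obtain n where n: "n \<in> ?I" "f (?w n) \<noteq> 0" by auto
    have "Polynomial.coeff p n = f (?w n)"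
      using n(1) by (simp add: p_def coeff_sum)
    then have "p \<noteq> 0" using n(2) by auto
    ultimately show ?thesis using that by blast
  next
    case False
    then obtain i j where ij: "i \<noteq> j" "?w i = ?w j"
      by (auto simp: inj_on_def)
    let ?p = "monom (1::'f) i + smult (-1) (monom 1 j)"
    have "poly_map T ?p v = 0"
      unfolding poly_map_add poly_map_smult poly_map_monom using ij(2) by simp
    moreover have "Polynomial.coeff ?p i = 1" using ij(1) by simp
    then have "?p \<noteq> 0" by (metis coeff_0 zero_neq_one)
    ultimately show ?thesis using that by blast
  qed
qed

text \<open>Take the product of annihilators of the basis vectors: the factors commute, so the one
  belonging to \<open>d\<close> can be applied first to \<open>basis_vec d\<close>.\<close>

lemma annihilator_exists:
  assumes fin: "finite D" and inv: "\<And>u. u \<in> matsuo_space D \<Longrightarrow> T u \<in> matsuo_space D"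
  shows "\<exists>p. p \<noteq> 0 \<and> (\<forall>u\<in>matsuo_space D. poly_map T p u = 0)"
proof -
  have "\<exists>p. p \<noteq> 0 \<and> poly_map T p (basis_vec d) = 0" if "d \<in> D" for d
    by (rule vector_annihilator[OF fin inv basis_vec_in_matsuo_space[OF that]]) auto
  then obtain p where p: "\<And>d. d \<in> D \<Longrightarrow> p d \<noteq> 0 \<and> poly_map T (p d) (basis_vec d) = 0"
    by metis
  let ?p = "\<Prod>d\<in>D. p d"
  have "poly_map T ?p u = 0" if "u \<in> matsuo_space D" for u
  proof -
    have "poly_map T ?p (basis_vec d) = 0" if "d \<in> D" for d
    proof -
      have "?p = (\<Prod>c\<in>D-{d}. p c) * p d"
        using fin that by (simp add: prod.remove mult.commute)
      then show ?thesis using p[OF that]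
        by (simp add: poly_map_mult fun_pair.linear_0[OF linear_poly_map])
    qed
    then show ?thesis
      by (subst matsuo_space_expand[OF fin that])
        (simp add: fun_pair.linear_sum[OF linear_poly_map] fun_pair.linear_scale[OF linear_poly_map])
  qed
  moreover have "?p \<noteq> 0" using fin p by simp
  ultimately show ?thesis by blast
qed

end

section \<open>Adjacency maps and involutive automorphisms of a finite graph\<close>

definition adjacency_map :: "'a set \<Rightarrow> ('a \<Rightarrow> 'a \<Rightarrow> bool) \<Rightarrow> ('a \<Rightarrow> 'f) \<Rightarrow> 'a \<Rightarrow> 'f::field" where
  "adjacency_map D E u = (\<lambda>x. if x \<in> D then \<Sum>d | d \<in> D \<and> E x d. u d else 0)"

text \<open>Pullback of functions along \<open>\<pi>\<close>. For an involution of \<open>D\<close>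
  it agrees on the Matsuo space with the linear map sending \<open>basis_vec d\<close> to
  \<open>basis_vec (\<pi> d)\<close>.\<close>

definition permute_map :: "'a set \<Rightarrow> ('a \<Rightarrow> 'a) \<Rightarrow> ('a \<Rightarrow> 'f) \<Rightarrow> 'a \<Rightarrow> 'f::field" where
  "permute_map D \<pi> u = (\<lambda>x. if x \<in> D then u (\<pi> x) else 0)"

definition graph_involution :: "'a set \<Rightarrow> ('a \<Rightarrow> 'a \<Rightarrow> bool) \<Rightarrow> ('a \<Rightarrow> 'a) \<Rightarrow> bool" where
  "graph_involution D E \<pi> \<longleftrightarrow>
     (\<forall>x\<in>D. \<pi> x \<in> D \<and> \<pi> (\<pi> x) = x) \<and> (\<forall>x\<in>D. \<forall>y\<in>D. E (\<pi> x) (\<pi> y) \<longleftrightarrow> E x y)"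

lemma linear_adjacency_map: "fun_linear (adjacency_map D E :: ('a \<Rightarrow> 'f::field) \<Rightarrow> 'a \<Rightarrow> 'f)"
  by (rule fun_linearI)
    (auto simp: adjacency_map_def fun_eq_iff sum.distrib scale_fun_def sum_distrib_left)

lemma linear_permute_map: "fun_linear (permute_map D \<pi> :: ('a \<Rightarrow> 'f::field) \<Rightarrow> 'a \<Rightarrow> 'f)"
  by (rule fun_linearI) (auto simp: permute_map_def fun_eq_iff scale_fun_def)

lemma adjacency_map_in_matsuo_space: "adjacency_map D E u \<in> matsuo_space D"
  by (simp add: adjacency_map_def matsuo_space_def)

lemma permute_map_in_matsuo_space: "permute_map D \<pi> u \<in> matsuo_space D"
  by (simp add: permute_map_def matsuo_space_def)

lemma permute_map_permute_map:
  assumes "graph_involution D E \<pi>" "u \<in> matsuo_space D"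
  shows "permute_map D \<pi> (permute_map D \<pi> u) = u"
  using assms by (auto simp: permute_map_def graph_involution_def matsuo_space_def fun_eq_iff)

lemma permute_map_adjacency_map:
  assumes "graph_involution D E \<pi>"
  shows "permute_map D \<pi> (adjacency_map D E u) = adjacency_map D E (permute_map D \<pi> u)"
proof
  fix x
  show "permute_map D \<pi> (adjacency_map D E u) x = adjacency_map D E (permute_map D \<pi> u) x"
  proof (cases "x \<in> D")
    case True
    have "(\<Sum>d | d \<in> D \<and> E (\<pi> x) d. u d) = (\<Sum>d | d \<in> D \<and> E x d. u (\<pi> d))"
      using assms True unfolding graph_involution_def
      by (intro sum.reindex_bij_witness[where i = \<pi> and j = \<pi>]) (auto, metis+)
    then show ?thesis
      using True assms by (simp add: permute_map_def adjacency_map_def graph_involution_def)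
  qed (simp add: permute_map_def adjacency_map_def)
qed

section \<open>Rationality of the spectrum of a sum of involutions\<close>

lemma trace_on_sum: "trace_on D (\<lambda>u. \<Sum>i\<in>I. f i u) = (\<Sum>i\<in>I. trace_on D (f i))"
  unfolding trace_on_def sum_fun_apply by (rule sum.swap)

lemma trace_on_add: "trace_on D (\<lambda>u. f u + g u) = trace_on D f + trace_on D g"
  by (simp add: trace_on_def sum.distrib)

lemma trace_on_diff: "trace_on D (\<lambda>u. f u - g u) = trace_on D f - trace_on D g"
  by (simp add: trace_on_def sum_subtractf)

lemma trace_on_scale: "trace_on D (\<lambda>u. scale_fun k (f u)) = k * trace_on D f"
  by (simp add: trace_on_def scale_fun_def sum_distrib_left)

text \<open>\<open>dim\<close> is also \<open>0\<close> for a space with an infinite basis, because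
  \<open>card\<close> is; containment in \<open>matsuo_space D\<close> excludes that case.\<close>

lemma dim_eq_0_imp:
  fixes V :: "('a \<Rightarrow> 'f::field) set"
  assumes "finite D" "V \<subseteq> matsuo_space D" "fun_space.dim V = 0" "v \<in> V"
  shows "v = 0"
proof -
  obtain B where B: "B \<subseteq> V" "fun_space.independent B" "V \<subseteq> fun_space.span B"
      "card B = fun_space.dim V"
    by (rule fun_space.basis_exists)
  then have "finite B" using independent_matsuo_space_bound[OF assms(1) B(2)] assms(2) by auto
  then have "B = {}" using B(4) assms(3) by simp
  then show ?thesis using B(3) assms(4) by auto
qed

text \<open>On \<open>V\<close> the involution is \<open>2 e - 1\<close> with \<open>e\<close> idempotent.\<close>

lemma trace_involution:
  fixes V :: "('a \<Rightarrow> 'f::field_char_0) set"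
  assumes fin: "finite D" and F: "fun_linear F" and FF: "\<And>v. v \<in> V \<Longrightarrow> F (F v) = v"
    and V: "fun_space.subspace V" "V \<subseteq> matsuo_space D" and inv: "\<And>v. v \<in> V \<Longrightarrow> F v \<in> V"
    and Q: "fun_linear Q" "\<And>u. Q u \<in> V" "\<And>v. v \<in> V \<Longrightarrow> Q v = v"
  shows "trace_on D (\<lambda>u. F (Q u)) =
    2 * of_nat (fun_space.dim {v \<in> V. F v = v}) - of_nat (fun_space.dim V)"
proof -
  let ?e = "\<lambda>u. scale_fun (1/2) (Q u + F (Q u))"
  have trQ: "trace_on D Q = of_nat (fun_space.dim V)"
    using Q by (intro trace_projection fin V) auto
  have "trace_on D ?e = of_nat (fun_space.dim {v \<in> V. F v = v})"
  proof (rule trace_projection[OF fin])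
    show "fun_linear ?e"
      by (rule fun_linearI)
        (simp_all add: fun_pair.linear_add[OF F] fun_pair.linear_add[OF Q(1)]
          fun_pair.linear_scale[OF F] fun_pair.linear_scale[OF Q(1)] fun_space.scale_right_distrib
          mult.commute del: plus_fun_apply)
    show "fun_space.subspace {v \<in> V. F v = v}"
      using V(1) by (auto simp: fun_space.subspace_def fun_pair.linear_0[OF F]
          fun_pair.linear_add[OF F] fun_pair.linear_scale[OF F])
    show "?e u \<in> {v \<in> V. F v = v}" for u
      using Q(2) inv V(1) FF
      by (auto simp: fun_pair.linear_add[OF F] fun_pair.linear_scale[OF F] add.commute
          intro!: fun_space.subspace_scale fun_space.subspace_add)
    show "?e v = v" if "v \<in> {v \<in> V. F v = v}" for v
      using that by (auto simp: Q(3) scale_fun_def fun_eq_iff)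
  qed (use V(2) in auto)
  moreover have "trace_on D ?e = 1/2 * (trace_on D Q + trace_on D (\<lambda>u. F (Q u)))"
    by (simp add: trace_on_scale trace_on_add)
  ultimately show ?thesis using trQ by (simp add: field_simps)
qed

text \<open>For a connected 3-transposition group \<open>C\<close> is \<open>D\<close> acting by
  conjugation, and \<open>k\<close> is the number of points not collinear with a given one. The last
  assumption is over the complex numbers, where the eigenvalue argument takes place.\<close>

locale involutions_sum_graph =
  fixes D :: "'a set" and E :: "'a \<Rightarrow> 'a \<Rightarrow> bool" and \<pi> :: "'c \<Rightarrow> 'a \<Rightarrow> 'a" and C :: "'c set"
    and k :: nat
  assumes finite_D: "finite D"
    and sym: "\<lbrakk>x \<in> D; y \<in> D; E x y\<rbrakk> \<Longrightarrow> E y x"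
    and involution: "c \<in> C \<Longrightarrow> graph_involution D E (\<pi> c)"
    and sum_involutions: "(u :: 'a \<Rightarrow> complex) \<in> matsuo_space D \<Longrightarrow>
      (\<Sum>c\<in>C. permute_map D (\<pi> c) u) = adjacency_map D E u + scale_fun (of_nat k) u"
begin

text \<open>On the eigenspace, of dimension \<open>n\<close>, the sum of the involutions is the
  scalar \<open>a + k\<close>, with trace \<open>(a + k) * n\<close>. Each involution commutes with
  the adjacency map, so it preserves the eigenspace and has integral trace on it.\<close>

lemma rational_eigenvalue:
  fixes u :: "'a \<Rightarrow> complex"
  assumes u: "u \<in> matsuo_space D" "u \<noteq> 0" "adjacency_map D E u = scale_fun a u"
  shows "a \<in> range of_rat"
proof -
  let ?T = "adjacency_map D E :: ('a \<Rightarrow> complex) \<Rightarrow> 'a \<Rightarrow> complex"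
  let ?V = "eigenspace ?T (matsuo_space D) a"
  let ?n = "fun_space.dim ?V"
  have V: "fun_space.subspace ?V" "?V \<subseteq> matsuo_space D"
    by (rule subspace_eigenspace[OF linear_adjacency_map subspace_matsuo_space])
      (auto simp: eigenspace_def)
  have "u \<in> ?V" using u by (simp add: eigenspace_def)
  then have n: "?n \<noteq> 0" using dim_eq_0_imp[OF finite_D V(2)] u(2) by blast
  \<comment> \<open>Composition with \<open>Q\<close> turns traces on the eigenspace into values of
    \<open>trace_on D\<close>.\<close>
  obtain Q where Q: "fun_linear Q" "\<And>u. Q u \<in> ?V" "\<And>v. v \<in> ?V \<Longrightarrow> Q v = v"
    using projection_exists[OF V(1)] by metis
  have trQ: "trace_on D Q = of_nat ?n"
    using Q by (intro trace_projection finite_D V) auto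
  define z where "z = (\<Sum>c\<in>C. 2 * int (fun_space.dim {v \<in> ?V. permute_map D (\<pi> c) v = v}) - int ?n)"
  have "trace_on D (\<lambda>u. permute_map D (\<pi> c) (Q u)) =
    of_int (2 * int (fun_space.dim {v \<in> ?V. permute_map D (\<pi> c) v = v}) - int ?n)" if "c \<in> C" for c
  proof -
    have "permute_map D (\<pi> c) v \<in> ?V" if "v \<in> ?V" for v
      using that permute_map_adjacency_map[OF involution[OF \<open>c \<in> C\<close>], of v]
      by (auto simp: eigenspace_def permute_map_in_matsuo_space fun_pair.linear_scale[OF linear_permute_map])
    then show ?thesis
      using V(2) permute_map_permute_map[OF involution[OF that]]
      by (subst trace_involution[OF finite_D linear_permute_map _ V _ Q]) auto
  qed
  then have "of_int z = trace_on D (\<lambda>u. \<Sum>c\<in>C. permute_map D (\<pi> c) (Q u))"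
    unfolding trace_on_sum z_def by simp
  also have "\<dots> = trace_on D (\<lambda>u. scale_fun (a + of_nat k) (Q u))"
    using sum_involutions Q(2) by (simp add: eigenspace_def fun_space.scale_left_distrib)
  also have "\<dots> = (a + of_nat k) * of_nat ?n"
    by (simp add: trace_on_scale trQ)
  finally have "a = of_int z / of_nat ?n - of_nat k"
    using n by (simp add: field_simps)
  also have "\<dots> = of_rat (of_int z / of_nat ?n - of_nat k)"
    by (simp add: of_rat_diff of_rat_divide)
  finally show ?thesis by blast
qed

text \<open>The adjacency matrix is real and symmetric, hence self-adjoint for the standard
  Hermitian form.\<close>

lemma adjacency_form_sym:
  fixes u v :: "'a \<Rightarrow> complex"
  shows "(\<Sum>x\<in>D. cnj (adjacency_map D E u x) * v x) = (\<Sum>x\<in>D. cnj (u x) * adjacency_map D E v x)"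
proof -
  have adj: "adjacency_map D E u x = (\<Sum>d\<in>D. if E x d then u d else 0)" if "x \<in> D"
    for u :: "'a \<Rightarrow> complex" and x
    using that finite_D by (simp add: adjacency_map_def sum.inter_filter)
  have "(\<Sum>x\<in>D. cnj (adjacency_map D E u x) * v x) =
      (\<Sum>x\<in>D. \<Sum>d\<in>D. if E x d then cnj (u d) * v x else 0)"
    by (intro sum.cong refl) (auto simp: adj sum_distrib_right intro!: sum.cong)
  also have "\<dots> = (\<Sum>d\<in>D. \<Sum>x\<in>D. if E x d then cnj (u d) * v x else 0)"
    by (rule sum.swap)
  also have "\<dots> = (\<Sum>d\<in>D. \<Sum>x\<in>D. if E d x then cnj (u d) * v x else 0)"
    using sym by (intro sum.cong refl if_cong) blast+
  also have "\<dots> = (\<Sum>x\<in>D. cnj (u x) * adjacency_map D E v x)"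
    by (intro sum.cong refl) (auto simp: adj sum_distrib_left intro!: sum.cong)
  finally show ?thesis .
qed

text \<open>With \<open>v = (T - a) w\<close> and \<open>(T - a) v = 0\<close>, self-adjointness and
  reality of \<open>a\<close> give \<open>\<langle>v, v\<rangle> = \<langle>v, (T - a) w\<rangle> =
  \<langle>(T - a) v, w\<rangle> = 0\<close>, and the form is positive definite.\<close>

lemma square_kernel:
  fixes w :: "'a \<Rightarrow> complex"
  assumes w: "w \<in> matsuo_space D" and a: "cnj a = a"
    and sq: "adjacency_map D E (adjacency_map D E w - scale_fun a w) =
      scale_fun a (adjacency_map D E w - scale_fun a w)"
  shows "adjacency_map D E w - scale_fun a w = 0"
proof -
  let ?T = "adjacency_map D E :: ('a \<Rightarrow> complex) \<Rightarrow> 'a \<Rightarrow> complex"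
  define v where "v = ?T w - scale_fun a w"
  have Tv: "?T v = scale_fun a v" using sq by (simp add: v_def)
  have mult_v: "c * v x = c * ?T w x - a * (c * w x)" for c x
    by (simp add: v_def scale_fun_def algebra_simps)
  have "(\<Sum>x\<in>D. cnj (v x) * v x) = (\<Sum>x\<in>D. cnj (v x) * ?T w x) - a * (\<Sum>x\<in>D. cnj (v x) * w x)"
    unfolding mult_v by (simp only: sum_subtractf sum_distrib_left)
  also have "(\<Sum>x\<in>D. cnj (v x) * ?T w x) = (\<Sum>x\<in>D. cnj (?T v x) * w x)"
    by (rule adjacency_form_sym[symmetric])
  also have "\<dots> = a * (\<Sum>x\<in>D. cnj (v x) * w x)"
    by (simp add: Tv scale_fun_def a algebra_simps sum_distrib_left)
  finally have "(\<Sum>x\<in>D. cnj (v x) * v x) = 0" by simp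
  then have "of_real (\<Sum>x\<in>D. (norm (v x))\<^sup>2) = (0::complex)"
    by (simp add: complex_norm_square mult.commute of_real_power[symmetric] del: of_real_power)
  then have "(\<Sum>x\<in>D. (norm (v x))\<^sup>2) = 0" by (simp only: of_real_eq_0_iff)
  then have "v x = 0" if "x \<in> D" for x
    using that finite_D by (simp add: sum_nonneg_eq_0_iff)
  moreover have "v \<in> matsuo_space D"
    using w by (simp add: v_def adjacency_map_in_matsuo_space fun_space.subspace_diff
        fun_space.subspace_scale subspace_matsuo_space)
  ultimately have "v = 0" by (auto simp: matsuo_space_def fun_eq_iff)
  then show ?thesis by (simp add: v_def)
qed

text \<open>An annihilator of least degree has only eigenvalues as roots, which are rational by
  \<open>rational_eigenvalue\<close>, and only simple roots by \<open>square_kernel\<close>.\<close>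

lemma complex_annihilator:
  obtains R :: "rat set" where "finite R"
    "\<And>u. u \<in> matsuo_space D \<Longrightarrow> poly_map (adjacency_map D E) (\<Prod>r\<in>R. [:- of_rat r, 1:]) u = (0 :: 'a \<Rightarrow> complex)"
proof -
  let ?T = "adjacency_map D E :: ('a \<Rightarrow> complex) \<Rightarrow> 'a \<Rightarrow> complex"
  note T = linear_adjacency_map[where 'f = complex, of D E]
  define kills where "kills p \<longleftrightarrow> p \<noteq> 0 \<and> (\<forall>u\<in>matsuo_space D. poly_map ?T p u = 0)" for p
  obtain p0 where "kills p0"
    using annihilator_exists[OF T finite_D adjacency_map_in_matsuo_space] by (auto simp: kills_def)
  then obtain p where p: "kills p" and min: "\<And>q. kills q \<Longrightarrow> degree p \<le> degree q"
    using ex_has_least_nat[of kills p0 degree] by blast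
  \<comment> \<open>By minimality of the degree, the cofactor of a root no longer kills the whole
    space; a nonzero value of it is then an eigenvector.\<close>
  have factor: "\<exists>u\<in>matsuo_space D. poly_map ?T q u \<noteq> 0" if "p = [:-a, 1:] * q" for a q
  proof -
    have "q \<noteq> 0" using p that by (auto simp: kills_def)
    then have "degree p = Suc (degree q)" using that degree_mult_eq[of "[:-a, 1:]" q] by simp
    then have "\<not> kills q" using min[of q] by auto
    then show ?thesis using \<open>q \<noteq> 0\<close> by (auto simp: kills_def)
  qed
  have eigen: "poly_map ?T q u \<in> matsuo_space D"
    "?T (poly_map ?T q u) = scale_fun a (poly_map ?T q u)"
    if "p = [:-a, 1:] * q" "u \<in> matsuo_space D" for a q u
  proof -
    show "poly_map ?T q u \<in> matsuo_space D"
      by (rule poly_map_in_subspace[OF T subspace_matsuo_space adjacency_map_in_matsuo_space that(2)])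
    have "poly_map ?T [:-a, 1:] (poly_map ?T q u) = 0"
      unfolding poly_map_mult[OF T, symmetric] using p that by (simp only: kills_def)
    then show "?T (poly_map ?T q u) = scale_fun a (poly_map ?T q u)"
      by (simp only: poly_map_root[OF T] right_minus_eq)
  qed
  have rat: "a \<in> range of_rat" if root: "poly p a = 0" for a
  proof -
    obtain q where q: "p = [:-a, 1:] * q"
      using root unfolding poly_eq_0_iff_dvd dvd_def by blast
    obtain u where u: "u \<in> matsuo_space D" "poly_map ?T q u \<noteq> 0"
      using factor[OF q] by blast
    show ?thesis
      by (rule rational_eigenvalue[OF eigen(1)[OF q u(1)] u(2) eigen(2)[OF q u(1)]])
  qed
  have "rsquarefree p"
    unfolding rsquarefree_roots
  proof (intro allI notI)
    fix a assume a: "poly p a = 0 \<and> poly (pderiv p) a = 0"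
    then obtain q where q: "p = [:-a, 1:] * q"
      unfolding poly_eq_0_iff_dvd dvd_def by blast
    \<comment> \<open>The derivative of \<open>(X - a) q\<close> is \<open>q + (X - a) q'\<close>,
      with value \<open>q(a)\<close> at \<open>a\<close>.\<close>
    have "poly q a = 0" using a by (simp add: q pderiv_pCons pderiv_diff pderiv_smult)
    then obtain r where r: "q = [:-a, 1:] * r"
      unfolding poly_eq_0_iff_dvd dvd_def by blast
    obtain u where u: "u \<in> matsuo_space D" "poly_map ?T q u \<noteq> 0"
      using factor[OF q] by blast
    \<comment> \<open>The nonzero eigenvector \<open>q(T) u\<close> equals \<open>(T - a) w\<close>,
      the situation that \<open>square_kernel\<close> rules out.\<close>
    define w where "w = poly_map ?T r u"
    have w: "w \<in> matsuo_space D" unfolding w_def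
      by (rule poly_map_in_subspace[OF T subspace_matsuo_space adjacency_map_in_matsuo_space u(1)])
    have qu: "poly_map ?T q u = ?T w - scale_fun a w"
      by (simp only: r w_def poly_map_mult[OF T] poly_map_root[OF T])
    obtain b where "a = of_rat b" using rat a by blast
    then have "cnj a = a"
      by (cases b) (simp add: of_rat_rat)
    then have "?T w - scale_fun a w = 0"
      using eigen(2)[OF q u(1)] unfolding qu by (intro square_kernel w)
    then show False using u(2) qu by simp
  qed
  then have dec: "smult (lead_coeff p) (\<Prod>z | poly p z = 0. [:-z, 1:]) = p"
    by (rule complex_poly_decompose_rsquarefree)
  define R :: "rat set" where "R = of_rat -` {z. poly p z = 0}"
  have "p \<noteq> 0" using p by (simp add: kills_def)
  then have fin: "finite {z. poly p z = 0}" by (rule poly_roots_finite)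
  have inj: "inj (of_rat :: rat \<Rightarrow> complex)" by (simp add: inj_def)
  have "finite R" unfolding R_def by (rule finite_vimageI[OF fin inj])
  \<comment> \<open>All roots are rational, so the preimage \<open>R\<close> misses none of
    them.\<close>
  have "of_rat ` R = {z. poly p z = 0}"
    using rat by (auto simp: R_def)
  then have "(\<Prod>z | poly p z = 0. [:-z, 1:]) = (\<Prod>r\<in>R. [:- of_rat r, 1:])"
    using prod.reindex[OF inj_on_subset[OF inj subset_UNIV], of "\<lambda>z. [:-z, 1:]" R]
    by (simp add: o_def)
  then have p_eq: "p = smult (lead_coeff p) (\<Prod>r\<in>R. [:- of_rat r, 1:])"
    using dec by simp
  show ?thesis
  proof (rule that[OF \<open>finite R\<close>])
    fix u :: "'a \<Rightarrow> complex" assume "u \<in> matsuo_space D"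
    then have "scale_fun (lead_coeff p) (poly_map ?T (\<Prod>r\<in>R. [:- of_rat r, 1:]) u) = 0"
      using p p_eq poly_map_smult[OF T, of "lead_coeff p" "\<Prod>r\<in>R. [:- of_rat r, 1:]" u]
      by (simp add: kills_def)
    then show "poly_map ?T (\<Prod>r\<in>R. [:- of_rat r, 1:]) u = 0"
      using \<open>p \<noteq> 0\<close> by simp
  qed
qed

text \<open>The adjacency matrix has entries \<open>0\<close> and \<open>1\<close>, so the embedding
  of the rationals commutes with every factor \<open>T - r\<close>.\<close>

lemma poly_map_of_rat:
  fixes u :: "'a \<Rightarrow> rat"
  assumes "finite R"
  shows "poly_map (adjacency_map D E) (\<Prod>r\<in>R. [:- of_rat r, 1:]) (\<lambda>x. of_rat (u x)) =
    (\<lambda>x. of_rat (poly_map (adjacency_map D E) (\<Prod>r\<in>R. [:- r, 1:]) u x) :: 'f::field_char_0)"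
  using assms
proof (induction R arbitrary: u)
  case (insert r R)
  have "poly_map (adjacency_map D E) [:- of_rat r, 1:] (\<lambda>x. of_rat (u x)) =
      (\<lambda>x. of_rat (poly_map (adjacency_map D E) [:- r, 1:] u x) :: 'f)" for u :: "'a \<Rightarrow> rat"
    unfolding poly_map_root[OF linear_adjacency_map]
    by (auto simp: adjacency_map_def scale_fun_def of_rat_diff of_rat_mult of_rat_sum fun_eq_iff)
  then show ?case
    unfolding prod.insert[OF insert.hyps] poly_map_mult[OF linear_adjacency_map] insert.IH by simp
qed (simp_all add: linear_adjacency_map)

text \<open>Basis vectors have rational coordinates. Vanishing on them descends from the complex
  numbers to the rationals by injectivity of \<open>of_rat\<close>, and then passes to any field of
  characteristic \<open>0\<close>.\<close>

lemma rational_annihilator: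
  obtains R :: "rat set" where "finite R"
    "\<And>u. u \<in> matsuo_space D \<Longrightarrow>
      poly_map (adjacency_map D E) (\<Prod>r\<in>R. [:- of_rat r, 1:]) u = (0 :: 'a \<Rightarrow> 'f::field_char_0)"
proof -
  obtain R :: "rat set" where R: "finite R"
    "\<And>u. u \<in> matsuo_space D \<Longrightarrow> poly_map (adjacency_map D E) (\<Prod>r\<in>R. [:- of_rat r, 1:]) u = (0 :: 'a \<Rightarrow> complex)"
    using complex_annihilator by metis
  \<comment> \<open>The target field stays general here, for use with both the complex numbers and
    \<open>'f\<close>.\<close>
  have basis: "(\<lambda>x. of_rat (basis_vec d x)) = (basis_vec d :: 'a \<Rightarrow> 'b::field_char_0)" for d
    by (auto simp: basis_vec_def)
  let ?p = "\<Prod>r\<in>R. [:- of_rat r, 1:] :: 'f poly"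
  have zero: "poly_map (adjacency_map D E) ?p (basis_vec d) = 0" if "d \<in> D" for d
  proof -
    have "(\<lambda>x. of_rat (poly_map (adjacency_map D E) (\<Prod>r\<in>R. [:- r, 1:]) (basis_vec d) x)) = (0 :: 'a \<Rightarrow> complex)"
      unfolding poly_map_of_rat[OF R(1), symmetric] basis
      by (rule R(2)[OF basis_vec_in_matsuo_space[OF that]])
    then have "poly_map (adjacency_map D E) (\<Prod>r\<in>R. [:- r, 1:]) (basis_vec d) = (0 :: 'a \<Rightarrow> rat)"
      by (simp add: fun_eq_iff)
    then show ?thesis
      using poly_map_of_rat[OF R(1), of "basis_vec d", where 'f = 'f] unfolding basis
      by (simp only: zero_fun_apply of_rat_0 zero_fun_def)
  qed
  have lin: "fun_linear (poly_map (adjacency_map D E) ?p :: ('a \<Rightarrow> 'f) \<Rightarrow> 'a \<Rightarrow> 'f)"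
    by (rule linear_poly_map[OF linear_adjacency_map])
  have "poly_map (adjacency_map D E) ?p u = 0" if "u \<in> matsuo_space D" for u
    by (subst matsuo_space_expand[OF finite_D that])
      (simp only: fun_pair.linear_sum[OF lin] fun_pair.linear_scale[OF lin] zero
        fun_space.scale_zero_right sum.neutral_const cong: sum.cong)
  then show ?thesis using R(1) that by blast
qed

end

section \<open>Eigenspaces inside the image of a projection\<close>

lemma dim_zero_space: "fun_space.dim {0 :: 'a \<Rightarrow> 'f::field} = 0"
  using fun_space.dim_span[of "{} :: ('a \<Rightarrow> 'f) set"]
    fun_space.dim_eq_card_independent[OF fun_space.independent_empty]
  by (simp add: fun_space.span_empty)

text \<open>Since a product of distinct linear factors kills the space, Lagrange interpolation
  yields the spectral projections \<open>E a\<close> of \<open>T\<close>. As \<open>P\<close>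
  commutes with \<open>T\<close>, the map \<open>E a\<close> after \<open>P\<close> projects onto
  the \<open>a\<close>-eigenspace in \<open>W\<close>, and \<open>T P\<close> is the sum of these
  maps with weights \<open>a\<close>.\<close>

lemma weighted_eigenspace_dim_sum:
  fixes T P :: "('a \<Rightarrow> 'f) \<Rightarrow> 'a \<Rightarrow> 'f::field_char_0"
  assumes fin: "finite D" "finite A" "A \<noteq> {}"
    and T: "fun_linear T" "\<And>u. u \<in> matsuo_space D \<Longrightarrow> T u \<in> matsuo_space D"
    and kill: "\<And>u. u \<in> matsuo_space D \<Longrightarrow> poly_map T (\<Prod>a\<in>A. [:-a, 1:]) u = 0"
    and P: "fun_linear P" "\<And>u. u \<in> matsuo_space D \<Longrightarrow> P u \<in> W" "\<And>w. w \<in> W \<Longrightarrow> P w = w"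
    and PT: "\<And>u. P (T u) = T (P u)"
    and W: "fun_space.subspace W" "W \<subseteq> matsuo_space D"
  shows "(\<Sum>l\<in>eigenvalues T (matsuo_space D). of_nat (fun_space.dim (eigenspace T W l)) * l) =
    trace_on D (\<lambda>u. T (P u))"
proof -
  define L where "L a = smult (\<Prod>b\<in>A-{a}. 1 / (a - b)) (\<Prod>b\<in>A-{a}. [:-b, 1:])" for a
  have poly_L: "poly (L a) x = (if x = a then 1 else 0)" if "a \<in> A" "x \<in> A" for a x
  proof (cases "x = a")
    case True
    then show ?thesis
      using fin(2) by (simp add: L_def poly_prod prod.distrib[symmetric])
  next
    case False
    then have "(\<Prod>b\<in>A-{a}. poly [:-b, 1:] x) = 0"
      using fin(2) that(2) by (intro prod_zero) auto
    then show ?thesis using False by (simp add: L_def poly_prod)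
  qed
  have "degree (L a) < card A" if "a \<in> A" for a
  proof -
    have "degree (L a) \<le> degree (\<Prod>b\<in>A-{a}. [:-b, 1:])"
      unfolding L_def by (rule degree_smult_le)
    also have "\<dots> \<le> (\<Sum>b\<in>A-{a}. degree [:-b, 1:])"
      using degree_prod_sum_le[of "A-{a}" "\<lambda>b. [:-b, 1:]"] fin(2) by (simp add: o_def)
    also have "\<dots> < card A"
      using fin that by (simp add: card_gt_0_iff)
    finally show ?thesis .
  qed
  then have deg: "degree (\<Sum>a\<in>A. L a) < card A"
    using fin by (intro degree_sum_less) (auto simp: card_gt_0_iff)
  \<comment> \<open>Both sides agree at the \<open>card A\<close> nodes and have smaller degree; for
    the constant \<open>1\<close> this uses that \<open>A\<close> is nonempty.\<close>
  have sum_L: "(\<Sum>a\<in>A. L a) = 1"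
  proof (rule poly_eqI_degree[of A])
    show "poly (\<Sum>a\<in>A. L a) x = poly 1 x" if "x \<in> A" for x
      using fin(2) that by (simp add: poly_sum poly_L)
  qed (use deg fin in \<open>auto simp: card_gt_0_iff\<close>)
  define E where "E a = poly_map T (L a)" for a
  have lin_E: "fun_linear (E a)" for a
    unfolding E_def by (rule linear_poly_map[OF T(1)])
  have PM: "P u \<in> matsuo_space D" if "u \<in> matsuo_space D" for u
    using P(2)[OF that] W(2) by auto
  have TE: "T (E a u) = scale_fun a (E a u)" if "a \<in> A" "u \<in> matsuo_space D" for a u
  proof -
    \<comment> \<open>The factor \<open>X - a\<close> completes \<open>L a\<close> to a scalar
      multiple of the annihilating product, so \<open>E a u\<close> is killed by
      \<open>T - a\<close>.\<close>
    have "[:-a, 1:] * L a = smult (\<Prod>b\<in>A-{a}. 1 / (a - b)) (\<Prod>a\<in>A. [:-a, 1:])"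
      unfolding L_def mult_smult_right using fin(2) that(1) by (simp only: prod.remove)
    then have "poly_map T [:-a, 1:] (E a u) = 0"
      unfolding E_def poly_map_mult[OF T(1), symmetric]
      by (simp only: poly_map_smult[OF T(1)] kill[OF that(2)] fun_space.scale_zero_right)
    then show ?thesis by (simp only: poly_map_root[OF T(1)] right_minus_eq)
  qed
  have trace_E: "trace_on D (\<lambda>u. E a (P u)) = of_nat (fun_space.dim (eigenspace T W a))" if "a \<in> A" for a
  proof (rule trace_projection[OF fin(1)])
    show "fun_linear (\<lambda>u. E a (P u))"
      using Vector_Spaces.linear_compose[OF P(1) lin_E] by (simp add: o_def)
    show "fun_space.subspace (eigenspace T W a)"
      by (rule subspace_eigenspace[OF T(1) W(1)])
    show "eigenspace T W a \<subseteq> matsuo_space D"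
      using W(2) by (auto simp: eigenspace_def)
    show "E a (P u) \<in> eigenspace T W a" if u: "u \<in> matsuo_space D" for u
    proof -
      have "E a (P u) = P (E a u)"
        unfolding E_def by (rule poly_map_commute[OF T(1) P(1) PT, symmetric])
      also have "\<dots> \<in> W"
        unfolding E_def by (intro P(2) poly_map_in_subspace[OF T(1) subspace_matsuo_space T(2) u])
      finally show ?thesis
        using TE[OF \<open>a \<in> A\<close> PM[OF u]] by (simp add: eigenspace_def)
    qed
    show "E a (P v) = v" if "v \<in> eigenspace T W a" for v
      using that P(3) poly_map_eigenvector[OF T(1), of v a "L a"] poly_L[OF \<open>a \<in> A\<close> \<open>a \<in> A\<close>]
      by (simp add: eigenspace_def E_def)
  qed
  have "T (P u) = (\<Sum>a\<in>A. scale_fun a (E a (P u)))" if "u \<in> matsuo_space D" for u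
  proof -
    have "P u = (\<Sum>a\<in>A. E a (P u))"
      unfolding E_def poly_map_sum[OF T(1), symmetric] sum_L poly_map_1[OF T(1)] ..
    then have "T (P u) = T (\<Sum>a\<in>A. E a (P u))" by (rule arg_cong)
    also have "\<dots> = (\<Sum>a\<in>A. T (E a (P u)))"
      by (rule fun_pair.linear_sum[OF T(1)])
    finally show ?thesis using TE PM[OF that] by simp
  qed
  then have "trace_on D (\<lambda>u. T (P u)) = trace_on D (\<lambda>u. \<Sum>a\<in>A. scale_fun a (E a (P u)))"
    unfolding trace_on_def by (intro sum.cong refl) (simp add: basis_vec_in_matsuo_space)
  also have "\<dots> = (\<Sum>a\<in>A. of_nat (fun_space.dim (eigenspace T W a)) * a)"
    by (simp add: trace_on_sum trace_on_scale trace_E mult.commute)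
  \<comment> \<open>\<open>A\<close> contains every eigenvalue, and any further element of
    \<open>A\<close> has a zero eigenspace.\<close>
  also have "\<dots> = (\<Sum>l\<in>eigenvalues T (matsuo_space D). of_nat (fun_space.dim (eigenspace T W l)) * l)"
  proof (rule sum.mono_neutral_right[OF fin(2)])
    show "eigenvalues T (matsuo_space D) \<subseteq> A"
    proof
      fix l assume "l \<in> eigenvalues T (matsuo_space D)"
      then obtain u where u: "u \<in> matsuo_space D" "u \<noteq> 0" "T u = scale_fun l u"
        by (auto simp: eigenvalues_def)
      have "scale_fun (poly (\<Prod>a\<in>A. [:-a, 1:]) l) u = 0"
        using kill[OF u(1)] poly_map_eigenvector[OF T(1) u(3)] by simp
      then have "poly (\<Prod>a\<in>A. [:-a, 1:]) l = 0" using u(2) by simp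
      then show "l \<in> A" using fin(2) by (auto simp: poly_prod)
    qed
    show "\<forall>l\<in>A - eigenvalues T (matsuo_space D). of_nat (fun_space.dim (eigenspace T W l)) * l = 0"
    proof
      fix l assume "l \<in> A - eigenvalues T (matsuo_space D)"
      then have "eigenspace T W l = {0}"
        using W fun_space.subspace_0[OF W(1)]
        by (auto simp: eigenvalues_def eigenspace_def fun_pair.linear_0[OF T(1)])
      then show "of_nat (fun_space.dim (eigenspace T W l)) * l = 0"
        by (simp add: dim_zero_space)
    qed
  qed
  finally show ?thesis ..
qed

section \<open>Traces of adjacency maps and the trace formula for a graph involution\<close>

lemma trace_adjacency_map:
  assumes "finite D" "\<And>x. x \<in> D \<Longrightarrow> \<not> E x x"
  shows "trace_on D (adjacency_map D E) = (0 :: 'f::field)"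
  unfolding trace_on_def adjacency_map_def
  using assms by (intro sum.neutral) (auto simp: basis_vec_def intro!: sum.neutral)

lemma trace_adjacency_permute_map:
  assumes fin: "finite D" and \<sigma>: "graph_involution D E \<sigma>"
  shows "trace_on D (\<lambda>u. adjacency_map D E (permute_map D \<sigma> u)) =
    (of_nat (card {d \<in> D. E d (\<sigma> d)}) :: 'f::field)"
proof -
  have "adjacency_map D E (permute_map D \<sigma> (basis_vec d)) d = (if E d (\<sigma> d) then 1 else 0 :: 'f)"
    if "d \<in> D" for d
  proof -
    have "adjacency_map D E (permute_map D \<sigma> (basis_vec d)) d =
        (\<Sum>x | x \<in> D \<and> E d x. if x = \<sigma> d then 1 else 0 :: 'f)"
      using \<sigma> that unfolding adjacency_map_def permute_map_def basis_vec_def graph_involution_def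
      by (auto intro!: sum.cong)
    also have "\<dots> = (if E d (\<sigma> d) then 1 else 0)"
      using fin \<sigma> that by (auto simp: graph_involution_def)
    finally show ?thesis .
  qed
  then show ?thesis
    using fin by (simp add: trace_on_def sum.If_cases Int_def)
qed

lemma flip_action_eq_permute_map:
  fixes u :: "'a \<Rightarrow> 'f::field"
  assumes fin: "finite D" and \<sigma>: "graph_involution D E \<sigma>"
  shows "flip_action D \<sigma> u = permute_map D \<sigma> u"
proof
  fix x
  have "flip_action D \<sigma> u x = (\<Sum>d\<in>D. if x = \<sigma> d then u d else 0)"
    unfolding flip_action_def linear_extension_def sum_fun_apply
    by (intro sum.cong) (auto simp: scale_fun_def basis_vec_def)
  \<comment> \<open>Pushing forward becomes pulling back because \<open>\<sigma>\<close> is its own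
    inverse on \<open>D\<close>; for \<open>x\<close> outside \<open>D\<close> no summand
    survives.\<close>
  also have "\<dots> = (\<Sum>d\<in>D. if d = \<sigma> x \<and> x \<in> D then u d else 0)"
    using \<sigma> by (intro sum.cong refl if_cong) (auto simp: graph_involution_def)
  also have "\<dots> = permute_map D \<sigma> u x"
    using fin \<sigma> by (cases "x \<in> D") (auto simp: permute_map_def graph_involution_def)
  finally show "flip_action D \<sigma> u x = permute_map D \<sigma> u x" .
qed

lemma collinearity_map_eq_adjacency_map:
  fixes u :: "'g \<Rightarrow> 'f::field"
  assumes fin: "finite D"
  shows "collinearity_map G D u = adjacency_map D (\<lambda>x d. group.ord G (x \<otimes>\<^bsub>G\<^esub> d) = 3) u"
proof
  fix x
  have "(\<Sum>c\<in>{c \<in> D. group.ord G (c \<otimes>\<^bsub>G\<^esub> d) = 3}. basis_vec c) x =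
      (if x \<in> D \<and> group.ord G (x \<otimes>\<^bsub>G\<^esub> d) = 3 then 1 else 0 :: 'f)" for d
    using fin by (simp add: sum_fun_apply basis_vec_def)
  then show "collinearity_map G D u x = adjacency_map D (\<lambda>x d. group.ord G (x \<otimes>\<^bsub>G\<^esub> d) = 3) u x"
    using fin by (auto simp: collinearity_map_def linear_extension_def adjacency_map_def sum_fun_apply
        scale_fun_def sum.inter_filter intro!: sum.cong)
qed

text \<open>The projection onto \<open>W\<close> is \<open>P = (1 - \<sigma>) / 2\<close>, so the
  weighted sum is \<open>(tr T - tr (T \<sigma>)) / 2\<close>. Irreflexivity makes the first trace
  zero.\<close>

lemma flip_commutator_eigenspace_sum:
  fixes A :: "'f::field_char_0 set"
  assumes fin: "finite D" "finite A" "A \<noteq> {}" and irrefl: "\<And>x. x \<in> D \<Longrightarrow> \<not> E x x"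
    and \<sigma>: "graph_involution D E \<sigma>"
    and kill: "\<And>u. u \<in> matsuo_space D \<Longrightarrow> poly_map (adjacency_map D E) (\<Prod>a\<in>A. [:-a, 1:]) u = 0"
  shows "2 * (\<Sum>l\<in>eigenvalues (adjacency_map D E) (matsuo_space D).
      of_nat (fun_space.dim (eigenspace (adjacency_map D E) (flip_commutator D \<sigma>) l)) * l) =
    - (of_nat (card {d \<in> D. E d (\<sigma> d)}) :: 'f)"
proof -
  let ?T = "adjacency_map D E :: ('a \<Rightarrow> 'f) \<Rightarrow> 'a \<Rightarrow> 'f" and ?M = "matsuo_space D :: ('a \<Rightarrow> 'f) set"
  let ?s = "permute_map D \<sigma> :: ('a \<Rightarrow> 'f) \<Rightarrow> 'a \<Rightarrow> 'f"
  let ?P = "\<lambda>u. scale_fun (1/2) (u - ?s u)"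
  let ?W = "flip_commutator D \<sigma> :: ('a \<Rightarrow> 'f) set"
  note T = linear_adjacency_map[where 'f = 'f, of D E]
  note s = linear_permute_map[where 'f = 'f, of D \<sigma>]
  note M = subspace_matsuo_space[where 'f = 'f, of D]
  have W_eq: "?W = {w \<in> ?M. ?s w = - w}"
  proof (intro equalityI subsetI)
    fix w assume "w \<in> ?W"
    then obtain u where u: "u \<in> ?M" "w = u - ?s u"
      by (auto simp: flip_commutator_def flip_action_eq_permute_map[OF fin(1) \<sigma>])
    then show "w \<in> {w \<in> ?M. ?s w = - w}"
      by (auto simp: fun_pair.linear_diff[OF s] permute_map_permute_map[OF \<sigma>] permute_map_in_matsuo_space
          intro!: fun_space.subspace_diff[OF M])
  next
    \<comment> \<open>An element \<open>w\<close> of the \<open>-1\<close>-eigenspace is the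
      commutator of \<open>w / 2\<close>.\<close>
    fix w assume w: "w \<in> {w \<in> ?M. ?s w = - w}"
    then have "w = scale_fun (1/2) w - ?s (scale_fun (1/2) w)"
      unfolding fun_pair.linear_scale[OF s] by (simp add: scale_fun_def fun_eq_iff)
    moreover have "scale_fun (1/2) w \<in> ?M" using w fun_space.subspace_scale[OF M] by blast
    ultimately show "w \<in> ?W"
      unfolding flip_commutator_def flip_action_eq_permute_map[OF fin(1) \<sigma>] by blast
  qed
  have "(\<Sum>l\<in>eigenvalues ?T ?M. of_nat (fun_space.dim (eigenspace ?T ?W l)) * l) =
      trace_on D (\<lambda>u. ?T (?P u))"
  proof (rule weighted_eigenspace_dim_sum[OF fin T adjacency_map_in_matsuo_space kill])
    show "fun_linear ?P"
      by (rule fun_linearI; unfold fun_pair.linear_add[OF s] fun_pair.linear_scale[OF s])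
        (simp_all add: scale_fun_def fun_eq_iff algebra_simps)
    show "?P u \<in> ?W" if "u \<in> ?M" for u
    proof -
      have "?s (?P u) = - ?P u"
        unfolding fun_pair.linear_scale[OF s] fun_pair.linear_diff[OF s]
          permute_map_permute_map[OF \<sigma> that]
        by (simp add: scale_fun_def fun_eq_iff field_simps)
      moreover have "?P u \<in> ?M"
        by (intro fun_space.subspace_scale[OF M] fun_space.subspace_diff[OF M] that
            permute_map_in_matsuo_space)
      ultimately show ?thesis unfolding W_eq by blast
    qed
    show "?P w = w" if "w \<in> ?W" for w
      using that by (simp add: W_eq scale_fun_def fun_eq_iff)
    show "?P (?T u) = ?T (?P u)" for u
      by (simp only: permute_map_adjacency_map[OF \<sigma>] fun_pair.linear_scale[OF T] fun_pair.linear_diff[OF T])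
    show "fun_space.subspace ?W"
      unfolding W_eq using M by (auto simp: fun_space.subspace_def fun_pair.linear_add[OF s]
          fun_pair.linear_0[OF s] fun_pair.linear_scale[OF s])
    show "?W \<subseteq> ?M" by (auto simp: W_eq)
  qed
  also have "\<dots> = 1/2 * (trace_on D ?T - trace_on D (\<lambda>u. ?T (?s u)))"
    by (simp add: fun_pair.linear_scale[OF T] fun_pair.linear_diff[OF T] trace_on_scale trace_on_diff)
  finally show ?thesis
    using fin irrefl \<sigma> by (simp add: trace_adjacency_map trace_adjacency_permute_map)
qed

section \<open>3-transposition groups\<close>

lemma (in group) inv_mult_cancel_left:
  "\<lbrakk>g \<in> carrier G; x \<in> carrier G\<rbrakk> \<Longrightarrow> inv g \<otimes> (g \<otimes> x) = x"
  by (simp add: m_assoc[symmetric])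

text \<open>Injectivity gives \<open>h x\<close> and \<open>x\<close> the same trivial powers, and
  these determine the order. It serves for conjugations and for the flip.\<close>

lemma (in group) ord_injective_endomorphism:
  assumes h: "\<And>x y. \<lbrakk>x \<in> carrier G; y \<in> carrier G\<rbrakk> \<Longrightarrow> h (x \<otimes> y) = h x \<otimes> h y"
    and closed: "\<And>x. x \<in> carrier G \<Longrightarrow> h x \<in> carrier G"
    and inj: "inj_on h (carrier G)" and x: "x \<in> carrier G"
  shows "ord (h x) = ord x"
proof -
  have hom: "h \<in> hom G G" using h closed by (auto simp: hom_def)
  interpret h: group_hom G G h
    by unfold_locales (rule hom)
  have "h x [^] n = \<one> \<longleftrightarrow> ord x dvd n" for n :: nat
  proof -
    have "h x [^] n = \<one> \<longleftrightarrow> h (x [^] n) = h \<one>"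
      using x by (simp add: h.hom_nat_pow)
    also have "\<dots> \<longleftrightarrow> x [^] n = \<one>"
      by (rule inj_on_eq_iff[OF inj]) (use x in auto)
    finally show ?thesis using x by (simp add: pow_eq_id)
  qed
  then show ?thesis
    using ord_unique[of "h x" "ord x"] x by simp
qed

context three_transposition_group
begin

lemma D_carrier: "d \<in> D \<Longrightarrow> d \<in> carrier G"
  using D_subset by blast

lemma D_square: "d \<in> D \<Longrightarrow> d \<otimes> d = \<one>"
  using D_order[of d] pow_eq_id[of d 2] D_carrier[of d] by (simp add: numeral_2_eq_2)

lemma D_inv: "d \<in> D \<Longrightarrow> inv d = d"
  using D_square D_carrier inv_equality by blast

lemma D_cancel: "\<lbrakk>d \<in> D; x \<in> carrier G\<rbrakk> \<Longrightarrow> d \<otimes> (d \<otimes> x) = x"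
  using D_square D_carrier by (simp add: m_assoc[symmetric])

lemma finite_D: "finite D"
  using finite_carrier D_subset finite_subset by blast

lemma ord_conjugate:
  assumes "g \<in> carrier G" "x \<in> carrier G"
  shows "ord (g \<otimes> x \<otimes> inv g) = ord x"
proof (rule ord_injective_endomorphism[OF _ _ _ assms(2), of "\<lambda>x. g \<otimes> x \<otimes> inv g"])
  show "g \<otimes> (x \<otimes> y) \<otimes> inv g = g \<otimes> x \<otimes> inv g \<otimes> (g \<otimes> y \<otimes> inv g)"
    if "x \<in> carrier G" "y \<in> carrier G" for x y
    using that assms(1) by (simp add: m_assoc inv_mult_cancel_left)
  show "inj_on (\<lambda>x. g \<otimes> x \<otimes> inv g) (carrier G)"
    using assms(1) by (auto simp: inj_on_def)
qed (use assms in auto)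

lemma ord_conjugate_mult:
  assumes "g \<in> carrier G" "x \<in> D" "y \<in> D"
  shows "ord ((g \<otimes> x \<otimes> inv g) \<otimes> (g \<otimes> y \<otimes> inv g)) = ord (x \<otimes> y)"
proof -
  have "(g \<otimes> x \<otimes> inv g) \<otimes> (g \<otimes> y \<otimes> inv g) = g \<otimes> (x \<otimes> y) \<otimes> inv g"
    using assms D_carrier by (simp add: m_assoc inv_mult_cancel_left)
  then show ?thesis using assms D_carrier ord_conjugate by simp
qed

abbreviation "collinear x y \<equiv> ord (x \<otimes> y) = 3"

lemma graph_involution_conjugation:
  assumes "c \<in> D"
  shows "graph_involution D collinear (\<lambda>x. c \<otimes> x \<otimes> c)"
proof -
  have closed: "c \<otimes> x \<otimes> c \<in> D" if "x \<in> D" for x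
    using D_normal[OF D_carrier[OF assms] that] D_inv[OF assms] by simp
  moreover have "c \<otimes> (c \<otimes> x \<otimes> c) \<otimes> c = x" if "x \<in> D" for x
    using assms that D_carrier D_square D_cancel by (simp add: m_assoc)
  moreover have "ord ((c \<otimes> x \<otimes> c) \<otimes> (c \<otimes> y \<otimes> c)) = ord (x \<otimes> y)" if "x \<in> D" "y \<in> D" for x y
    using ord_conjugate_mult[OF D_carrier[OF assms] that] D_inv[OF assms] by simp
  ultimately show ?thesis by (simp add: graph_involution_def)
qed

lemma not_collinear_refl: "x \<in> D \<Longrightarrow> \<not> collinear x x"
  using D_square by simp

lemma collinear_sym:
  assumes "x \<in> D" "y \<in> D"
  shows "ord (x \<otimes> y) = ord (y \<otimes> x)"
proof -
  have "inv (x \<otimes> y) = y \<otimes> x"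
    using assms D_carrier D_inv by (simp add: inv_mult_group)
  then show ?thesis using ord_inv[of "x \<otimes> y"] assms D_carrier by simp
qed

text \<open>The relation \<open>(x c)^3 = 1\<close> reads \<open>(x c x)(c x c) = 1\<close>, and
  \<open>c x c\<close> is its own inverse.\<close>

lemma conjugate_collinear:
  assumes "c \<in> D" "x \<in> D" "collinear x c"
  shows "c \<otimes> x \<otimes> c = x \<otimes> c \<otimes> x"
proof -
  have "(x \<otimes> c) [^] (3::nat) = \<one>"
    using assms D_carrier pow_eq_id by simp
  then have "(x \<otimes> c \<otimes> x) \<otimes> (c \<otimes> x \<otimes> c) = \<one>"
    using assms D_carrier by (simp add: numeral_3_eq_3 m_assoc)
  then have "inv (c \<otimes> x \<otimes> c) = x \<otimes> c \<otimes> x"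
    using assms D_carrier by (intro inv_equality) auto
  moreover have "inv (c \<otimes> x \<otimes> c) = c \<otimes> x \<otimes> c"
    using assms D_carrier D_inv by (simp add: inv_mult_group m_assoc)
  ultimately show ?thesis by simp
qed

text \<open>Order \<open>0\<close> is excluded by finiteness, so the order of \<open>x c\<close> is
  \<open>1\<close> or \<open>2\<close>; in both cases \<open>x\<close> and \<open>c\<close>
  commute.\<close>

lemma conjugate_not_collinear:
  assumes "c \<in> D" "x \<in> D" "\<not> collinear x c"
  shows "c \<otimes> x \<otimes> c = x"
proof -
  have xc: "x \<otimes> c \<in> carrier G" using assms D_carrier by simp
  have "ord (x \<otimes> c) \<ge> 1" using ord_ge_1[OF finite_carrier xc] .
  then have "ord (x \<otimes> c) = 1 \<or> ord (x \<otimes> c) = 2"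
    using ord_mult_le[OF assms(2,1)] assms(3) by linarith
  then have "ord (x \<otimes> c) dvd 2" by auto
  then have "(x \<otimes> c) [^] (2::nat) = \<one>" using pow_eq_id[OF xc] by blast
  then have "(x \<otimes> c) \<otimes> (x \<otimes> c) = \<one>" using xc by (simp add: numeral_2_eq_2)
  then have "x \<otimes> (c \<otimes> x \<otimes> c) = \<one>" using assms D_carrier by (simp add: m_assoc)
  then have "inv (c \<otimes> x \<otimes> c) = x"
    using assms D_carrier by (intro inv_equality) auto
  moreover have "inv (c \<otimes> x \<otimes> c) = c \<otimes> x \<otimes> c"
    using assms D_carrier D_inv by (simp add: inv_mult_group m_assoc)
  ultimately show ?thesis by simp
qed

text \<open>Collinear points \<open>x\<close>, \<open>c\<close> have the same third point \<open>c x c = x c x\<close> on their line, while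
  conjugation by a non-collinear \<open>c\<close> fixes \<open>x\<close>; so the sum of all conjugations differs from the
  collinearity map by a diagonal map.\<close>

lemma sum_conjugates:
  fixes u :: "'a \<Rightarrow> 'f::field"
  assumes x: "x \<in> D"
  shows "(\<Sum>c\<in>D. u (c \<otimes> x \<otimes> c)) =
    (\<Sum>c | c \<in> D \<and> collinear x c. u c) + of_nat (card {c \<in> D. \<not> collinear x c}) * u x"
proof -
  \<comment> \<open>Conjugation by \<open>x\<close> fixes \<open>x\<close> and preserves
    collinearity, so it permutes the points collinear with \<open>x\<close>.\<close>
  have inv: "x \<otimes> c \<otimes> x \<in> D \<and> x \<otimes> (x \<otimes> c \<otimes> x) \<otimes> x = c \<and> (collinear x (x \<otimes> c \<otimes> x) \<longleftrightarrow> collinear x c)"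
    if "c \<in> D" for c
    using graph_involution_conjugation[OF x] that x D_square[OF x] D_carrier[OF x]
    unfolding graph_involution_def by (metis r_one m_closed l_one)
  have "(\<Sum>c\<in>D. u (c \<otimes> x \<otimes> c)) = (\<Sum>c | c \<in> D \<and> collinear x c. u (c \<otimes> x \<otimes> c)) +
      (\<Sum>c | c \<in> D \<and> \<not> collinear x c. u (c \<otimes> x \<otimes> c))"
    using finite_D by (subst sum.union_disjoint[symmetric]) (auto intro: sum.cong)
  also have "(\<Sum>c | c \<in> D \<and> collinear x c. u (c \<otimes> x \<otimes> c)) = (\<Sum>c | c \<in> D \<and> collinear x c. u c)"
    using inv
    by (intro sum.reindex_bij_witness[where i = "\<lambda>c. x \<otimes> c \<otimes> x" and j = "\<lambda>c. x \<otimes> c \<otimes> x"])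
      (auto simp: conjugate_collinear[OF _ x])
  also have "(\<Sum>c | c \<in> D \<and> \<not> collinear x c. u (c \<otimes> x \<otimes> c)) = (\<Sum>c | c \<in> D \<and> \<not> collinear x c. u x)"
    using conjugate_not_collinear x by (intro sum.cong) auto
  finally show ?thesis by simp
qed

end

section \<open>Consequences of connectedness\<close>

context connected_three_transposition_group
begin

text \<open>Conjugation acts transitively on \<open>D\<close> and preserves collinearity. This makes
  the diagonal term in \<open>sum_conjugates\<close> a scalar.\<close>

lemma card_not_collinear:
  assumes "x \<in> D" "y \<in> D"
  shows "card {c \<in> D. \<not> collinear x c} = card {c \<in> D. \<not> collinear y c}"
proof -
  have le: "card {c \<in> D. \<not> collinear x c} \<le> card {c \<in> D. \<not> collinear y c}" if "x \<in> D" "y \<in> D" for x y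
  proof -
    obtain d where d: "d \<in> carrier G" "D = {g \<otimes> d \<otimes> inv g | g. g \<in> carrier G}"
      using single_class by blast
    obtain g h where g: "g \<in> carrier G" "x = g \<otimes> d \<otimes> inv g" and h: "h \<in> carrier G" "y = h \<otimes> d \<otimes> inv h"
      using d(2) \<open>x \<in> D\<close> \<open>y \<in> D\<close> by auto
    \<comment> \<open>With \<open>x\<close> and \<open>y\<close> written as conjugates of
      \<open>d\<close> by \<open>g\<close> and \<open>h\<close>, this element conjugates
      \<open>x\<close> to \<open>y\<close>.\<close>
    define k where "k = h \<otimes> inv g"
    have k: "k \<in> carrier G" using g h by (simp add: k_def)
    have y: "y = k \<otimes> x \<otimes> inv k"
      using g h d(1) by (simp add: k_def m_assoc inv_mult_group inv_mult_cancel_left)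
    show ?thesis
    proof (rule card_inj_on_le[of "\<lambda>c. k \<otimes> c \<otimes> inv k"])
      show "inj_on (\<lambda>c. k \<otimes> c \<otimes> inv k) {c \<in> D. \<not> collinear x c}"
        using k D_carrier by (auto simp: inj_on_def)
      show "(\<lambda>c. k \<otimes> c \<otimes> inv k) ` {c \<in> D. \<not> collinear x c} \<subseteq> {c \<in> D. \<not> collinear y c}"
        using k that D_normal ord_conjugate_mult unfolding y by auto
    qed (use finite_D in auto)
  qed
  show ?thesis using le[OF assms] le[OF assms(2,1)] by simp
qed

lemma D_nonempty: "D \<noteq> {}"
proof -
  obtain d where "d \<in> carrier G" "D = {g \<otimes> d \<otimes> inv g | g. g \<in> carrier G}"
    using single_class by blast
  then have "\<one> \<otimes> d \<otimes> inv \<one> \<in> D" by blast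
  then show ?thesis by blast
qed

lemma collinearity_annihilator:
  obtains A :: "'f::field_char_0 set" where "finite A" "A \<noteq> {}"
    "\<And>u. u \<in> matsuo_space D \<Longrightarrow> poly_map (adjacency_map D collinear) (\<Prod>a\<in>A. [:-a, 1:]) u = 0"
proof -
  obtain x0 where x0: "x0 \<in> D" using D_nonempty by blast
  let ?k = "card {c \<in> D. \<not> collinear x0 c}"
  \<comment> \<open>The constant is computed at \<open>x0\<close> and transferred to the other
    points by \<open>card_not_collinear\<close>. Off \<open>D\<close> all functions involved
    vanish.\<close>
  interpret involutions_sum_graph D collinear "\<lambda>c x. c \<otimes> x \<otimes> c" D ?k
  proof
    fix u :: "'a \<Rightarrow> complex" assume u: "u \<in> matsuo_space D"
    show "(\<Sum>c\<in>D. permute_map D (\<lambda>x. c \<otimes> x \<otimes> c) u) = adjacency_map D collinear u + scale_fun (of_nat ?k) u"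
    proof
      fix x
      show "(\<Sum>c\<in>D. permute_map D (\<lambda>x. c \<otimes> x \<otimes> c) u) x = (adjacency_map D collinear u + scale_fun (of_nat ?k) u) x"
        using u sum_conjugates[of x u] card_not_collinear[OF x0, of x]
        by (cases "x \<in> D")
          (simp_all add: sum_fun_apply permute_map_def adjacency_map_def scale_fun_def matsuo_space_def)
    qed
  qed (use finite_D collinear_sym graph_involution_conjugation in auto)
  obtain R :: "rat set" where R: "finite R"
    "\<And>u. u \<in> matsuo_space D \<Longrightarrow>
      poly_map (adjacency_map D collinear) (\<Prod>r\<in>R. [:- of_rat r, 1:]) u = (0 :: 'a \<Rightarrow> 'f)"
    using rational_annihilator by metis
  have eq: "(\<Prod>a\<in>of_rat ` R. [:-a, 1:]) = (\<Prod>r\<in>R. [:- of_rat r, 1:] :: 'f poly)"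
    by (subst prod.reindex) (auto simp: inj_on_def)
  \<comment> \<open>An empty \<open>R\<close> would give the empty product \<open>1\<close>, which
    acts as the identity and does not kill a nonzero vector.\<close>
  have "basis_vec x0 \<noteq> (0 :: 'a \<Rightarrow> 'f)"
    by (auto simp: basis_vec_def fun_eq_iff)
  then have "R \<noteq> {}"
    using R(2)[OF basis_vec_in_matsuo_space[OF x0]] by (auto simp: poly_map_1[OF linear_adjacency_map])
  then show ?thesis
    using that[of "of_rat ` R"] R unfolding eq by blast
qed

end

section \<open>The flip as an automorphism of the collinearity graph, and its orbits\<close>

context three_transposition_group
begin

lemma flip_on_carrier:
  assumes "flip G D \<sigma>"
  shows "\<And>x. x \<in> carrier G \<Longrightarrow> \<sigma> x \<in> carrier G"
    and "\<And>x y. \<lbrakk>x \<in> carrier G; y \<in> carrier G\<rbrakk> \<Longrightarrow> \<sigma> (x \<otimes> y) = \<sigma> x \<otimes> \<sigma> y"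
    and "inj_on \<sigma> (carrier G)"
    and "\<sigma> \<otimes>\<^bsub>AutoGroup G\<^esub> \<sigma> = \<one>\<^bsub>AutoGroup G\<^esub>"
    and "\<And>x. x \<in> carrier G \<Longrightarrow> \<sigma> (\<sigma> x) = x"
proof -
  interpret A: group "AutoGroup G" by (rule AutoGroup)
  have \<sigma>: "\<sigma> \<in> carrier (AutoGroup G)" "group.ord (AutoGroup G) \<sigma> = 2"
    using assms by (simp_all add: flip_def)
  then have auto: "\<sigma> \<in> hom G G" "\<sigma> \<in> Bij (carrier G)"
    by (auto simp: AutoGroup_def auto_def)
  then show "\<And>x. x \<in> carrier G \<Longrightarrow> \<sigma> x \<in> carrier G"
    "\<And>x y. \<lbrakk>x \<in> carrier G; y \<in> carrier G\<rbrakk> \<Longrightarrow> \<sigma> (x \<otimes> y) = \<sigma> x \<otimes> \<sigma> y"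
    "inj_on \<sigma> (carrier G)"
    by (auto simp: hom_def Bij_def bij_betw_def)
  show eq: "\<sigma> \<otimes>\<^bsub>AutoGroup G\<^esub> \<sigma> = \<one>\<^bsub>AutoGroup G\<^esub>"
    using \<sigma> A.pow_eq_id[of \<sigma> 2] by (simp add: numeral_2_eq_2)
  \<comment> \<open>Product and unit of \<open>AutoGroup G\<close> are restricted to the carrier, so
    \<open>\<sigma>\<close> is seen to be an involution there only.\<close>
  then have "compose (carrier G) \<sigma> \<sigma> = (\<lambda>x\<in>carrier G. x)"
    using auto(2) by (simp add: AutoGroup_def BijGroup_def)
  then show "\<And>x. x \<in> carrier G \<Longrightarrow> \<sigma> (\<sigma> x) = x"
    by (metis compose_eq restrict_apply')
qed

lemma graph_involution_flip:
  assumes "flip G D \<sigma>"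
  shows "graph_involution D collinear \<sigma>"
proof -
  note \<sigma> = flip_on_carrier[OF assms]
  have "\<sigma> ` D = D" using assms by (simp add: flip_def)
  moreover have "ord (\<sigma> x \<otimes> \<sigma> y) = ord (x \<otimes> y)" if "x \<in> D" "y \<in> D" for x y
    using ord_injective_endomorphism[of \<sigma> "x \<otimes> y"] \<sigma> that D_carrier by simp
  ultimately show ?thesis
    using \<sigma>(5) D_carrier by (auto simp: graph_involution_def)
qed

lemma flip_orbits_eq:
  assumes "flip G D \<sigma>"
  shows "flip_orbits G D \<sigma> = (\<lambda>c. {c, \<sigma> c}) ` D"
proof -
  interpret A: group "AutoGroup G" by (rule AutoGroup)
  have \<sigma>: "\<sigma> \<in> carrier (AutoGroup G)" using assms by (simp add: flip_def)
  note sq = flip_on_carrier(4)[OF assms]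
  \<comment> \<open>As \<open>\<sigma>\<close> is its own inverse, the set on the right is closed
    under products and inverses.\<close>
  have "generate (AutoGroup G) {\<sigma>} = {\<one>\<^bsub>AutoGroup G\<^esub>, \<sigma>}"
  proof (intro equalityI subsetI)
    fix \<tau> assume "\<tau> \<in> generate (AutoGroup G) {\<sigma>}"
    then show "\<tau> \<in> {\<one>\<^bsub>AutoGroup G\<^esub>, \<sigma>}"
    proof induction
      case (inv h)
      then show ?case using A.inv_equality[OF sq \<sigma> \<sigma>] by simp
    next
      case (eng h1 h2)
      then show ?case using \<sigma> sq by auto
    qed auto
  next
    fix \<tau> assume "\<tau> \<in> {\<one>\<^bsub>AutoGroup G\<^esub>, \<sigma>}"
    then show "\<tau> \<in> generate (AutoGroup G) {\<sigma>}"
      by (auto intro: generate.one generate.incl)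
  qed
  moreover have "\<one>\<^bsub>AutoGroup G\<^esub> c = c" if "c \<in> D" for c
    using that D_carrier by (simp add: AutoGroup_def BijGroup_def)
  moreover have "{\<tau> c | \<tau>. \<tau> \<in> {\<rho>, \<sigma>}} = {\<rho> c, \<sigma> c}" for c \<rho>
    by auto
  ultimately show ?thesis
    unfolding flip_orbits_def by (intro image_cong refl) simp
qed

text \<open>The set on the left is the disjoint union of the nonorthogonal orbits: it is
  \<open>\<sigma>\<close>-stable since collinearity is symmetric, and contains no fixed point of
  \<open>\<sigma>\<close> since no point is collinear with itself.\<close>

lemma card_nonorthogonal_orbits:
  assumes "flip G D \<sigma>"
  shows "card {d \<in> D. collinear d (\<sigma> d)} = 2 * card (nonorthogonal_orbits G D \<sigma>)"
proof -
  let ?F = "{d \<in> D. collinear d (\<sigma> d)}"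
  have \<sigma>: "\<And>d. d \<in> D \<Longrightarrow> \<sigma> d \<in> D \<and> \<sigma> (\<sigma> d) = d"
    using graph_involution_flip[OF assms] by (simp add: graph_involution_def)
  have F: "\<sigma> d \<in> ?F \<and> d \<noteq> \<sigma> d" if "d \<in> ?F" for d
    using that \<sigma> collinear_sym not_collinear_refl by (metis (mono_tags, lifting) mem_Collect_eq)
  have N: "nonorthogonal_orbits G D \<sigma> = (\<lambda>d. {d, \<sigma> d}) ` ?F"
  proof (intro equalityI subsetI)
    fix Q assume "Q \<in> nonorthogonal_orbits G D \<sigma>"
    \<comment> \<open>The representative \<open>c\<close> witnessing order \<open>3\<close> may
      differ from the representative \<open>d\<close> known to lie in \<open>D\<close>; being in the
      same orbit, it lies in \<open>D\<close> too.\<close>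
    then obtain d c where "d \<in> D" "Q = {d, \<sigma> d}" "Q = {c, \<sigma> c}" "collinear c (\<sigma> c)"
      by (auto simp: nonorthogonal_orbits_def flip_orbits_eq[OF assms])
    moreover from this have "c \<in> {d, \<sigma> d}" by blast
    then have "c \<in> D" using \<open>d \<in> D\<close> \<sigma> by auto
    ultimately show "Q \<in> (\<lambda>d. {d, \<sigma> d}) ` ?F" by blast
  next
    fix Q assume "Q \<in> (\<lambda>d. {d, \<sigma> d}) ` ?F"
    then obtain d where d: "d \<in> ?F" "Q = {d, \<sigma> d}" by blast
    then have "card Q = 2" using F by auto
    then show "Q \<in> nonorthogonal_orbits G D \<sigma>"
      using d by (auto simp: nonorthogonal_orbits_def flip_orbits_eq[OF assms])
  qed
  \<comment> \<open>An orbit is determined by any of its elements, so distinct orbits are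
    disjoint.\<close>
  have pair: "Q = {x, \<sigma> x}" if Q: "Q \<in> (\<lambda>d. {d, \<sigma> d}) ` ?F" and x: "x \<in> Q" for Q x
  proof -
    obtain d where d: "d \<in> D" "Q = {d, \<sigma> d}" using Q by blast
    then have "x = d \<or> x = \<sigma> d" using x by blast
    then show ?thesis using d \<sigma>[OF d(1)] by (auto simp: insert_commute)
  qed
  have "2 * card ((\<lambda>d. {d, \<sigma> d}) ` ?F) = card (\<Union>((\<lambda>d. {d, \<sigma> d}) ` ?F))"
  proof (rule card_partition)
    show "card Q = 2" if "Q \<in> (\<lambda>d. {d, \<sigma> d}) ` ?F" for Q
      using that F by auto
    fix Q Q' assume Q: "Q \<in> (\<lambda>d. {d, \<sigma> d}) ` ?F" and Q': "Q' \<in> (\<lambda>d. {d, \<sigma> d}) ` ?F"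
      and "Q \<noteq> Q'"
    have "x \<notin> Q'" if "x \<in> Q" for x
      using pair[OF Q that] pair[OF Q'] \<open>Q \<noteq> Q'\<close> by metis
    then show "Q \<inter> Q' = {}" by blast
  qed (use finite_D in auto)
  also have "\<Union>((\<lambda>d. {d, \<sigma> d}) ` ?F) = ?F" using F by blast
  finally show ?thesis using N by simp
qed

end

theorem corollary8p5:
  fixes G :: "('g, 'm) monoid_scheme" and D :: "'g set" and \<sigma> :: "'g \<Rightarrow> 'g"
    and \<eta> :: "'f::field_char_0"
  assumes "connected_three_transposition_group G D"
    and "\<eta> \<noteq> 0" and "\<eta> \<noteq> 1"
    and "flip G D \<sigma>"
  shows "(\<Sum>l\<in>eigenvalues (collinearity_map G D) (matsuo_space D :: ('g \<Rightarrow> 'f) set).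
            of_nat (fun_space.dim (eigenspace (collinearity_map G D) (flip_commutator D \<sigma>) l)) * l)
         = - of_nat (card (nonorthogonal_orbits G D \<sigma>))"
proof -
  interpret connected_three_transposition_group G D by fact
  obtain A :: "'f set" where A: "finite A" "A \<noteq> {}"
    "\<And>u. u \<in> matsuo_space D \<Longrightarrow> poly_map (adjacency_map D collinear) (\<Prod>a\<in>A. [:-a, 1:]) u = 0"
    using collinearity_annihilator by metis
  have "collinearity_map G D = (adjacency_map D collinear :: ('g \<Rightarrow> 'f) \<Rightarrow> 'g \<Rightarrow> 'f)"
    using collinearity_map_eq_adjacency_map[OF finite_D] by blast
  \<comment> \<open>The factor \<open>2\<close> on the left clears the denominator of the projection
    \<open>(1 - \<sigma>) / 2\<close>; the one on the right counts the two points of each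
    nonorthogonal orbit.\<close>
  then have "2 * (\<Sum>l\<in>eigenvalues (collinearity_map G D) (matsuo_space D :: ('g \<Rightarrow> 'f) set).
        of_nat (fun_space.dim (eigenspace (collinearity_map G D) (flip_commutator D \<sigma>) l)) * l) =
      2 * - of_nat (card (nonorthogonal_orbits G D \<sigma>))"
    using flip_commutator_eigenspace_sum[OF finite_D A(1,2) not_collinear_refl
        graph_involution_flip[OF assms(4)] A(3)] card_nonorthogonal_orbits[OF assms(4)]
    by simp
  \<comment> \<open>Characteristic \<open>0\<close> allows cancelling \<open>2\<close>.\<close>
  then show ?thesis by (simp only: mult_cancel_left) simp
qed

end
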